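(* There exists a real number $\alpha>1.77898$ such that $\neg SD(0,1,\infty;\alpha)$ holds. That is, there exists a finite set $G\subset\mathbb{R}^2$ such that $\pi_{-1}$ is injective on $G$ and $$\alpha=\frac{\log|G|}{\max\{\log|\pi_0(G)|,\ \log|\pi_1(G)|,\ \log|\pi_\infty(G)|\}}.$$
   Context: For $r\in\mathbb{Q}\cup\{\infty\}$ define $\pi_r:\mathbb{R}^2\to\mathbb{R}$ by $\pi_r(a,b)=a+rb$, with the convention $\pi_\infty(a,b)=b$. For a finite set $A$, $|A|$ denotes its cardinality. For $r_1,\dots,r_n\in\mathbb{Q}\cup\{\infty\}\setminus\{-1\}$ and a real number $\alpha$, the statement $\neg SD(r_1,\dots,r_n;\alpha)$ means: there exists a finite set $G\subset\mathbb{R}^2$ such that $\pi_{-1}$ (i.e. $(a,b)\mapsto a-b$) is injective on $G$ and $\alpha=\frac{\log|G|}{\max_j \log|\pi_{r_j}(G)|}$. *)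

theory Defs
  imports Complex_Main
begin

datatype slope = Fin rat | Infty

fun proj :: "slope \<Rightarrow> real \<times> real \<Rightarrow> real" where
  "proj (Fin r) (a, b) = a + of_rat r * b"
| "proj Infty (a, b) = b"

(* The negation of SD(r_1,...,r_n; alpha), for a nonempty list of slopes different from -1.
   The condition that the maximum is nonzero says that the quotient is defined; without it
   the convention x / 0 = 0 would admit degenerate G (empty or a single point) for alpha = 0.
   The base of the logarithm cancels in the quotient. *)
definition not_SD :: "slope list \<Rightarrow> real \<Rightarrow> bool" where
  "not_SD rs \<alpha> \<longleftrightarrow>
     rs \<noteq> [] \<and> Fin (- 1) \<notin> set rs \<and>
     (\<exists>G :: (real \<times> real) set. finite G \<and> inj_on (proj (Fin (- 1))) G \<and>
        Max ((\<lambda>r. ln (real (card (proj r ` G)))) ` set rs) \<noteq> 0 \<and>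
        \<alpha> = ln (real (card G)) / Max ((\<lambda>r. ln (real (card (proj r ` G)))) ` set rs))"

end

theory Submission
  imports Defs "HOL-Combinatorics.Multiset_Permutations" "HOL-Analysis.Harmonic_Numbers" "HOL-Real_Asymp.Real_Asymp"
begin

text \<open>
  Take a finitely supported rational distribution on \<open>\<int>\<^sup>2\<close> on which
  \<open>a - b\<close> is injective, and let \<open>G\<close> consist of all words of points whose letter frequencies are
  exactly that distribution, each word being read as a pair of numbers in a large base. Then \<open>a - b\<close>
  is injective on \<open>G\<close>, and \<open>\<pi>\<^sub>r(G)\<close> is contained in the set of words whose letter frequencies are the
  push-forward under \<open>\<pi>\<^sub>r\<close>. Multinomial asymptotics turn the logarithmic ratio into the ratio of the entropy of the
  distribution to the largest entropy of its three push-forwards, so that it remains to exhibit a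
  distribution on seven points for which this ratio of entropies exceeds 1.77898.
\<close>

section \<open>Counting words of a given type\<close>

text \<open>Shannon entropy in nats of the letter frequencies, multiplied by \<open>size A\<close>.
  A multiset and its images have equal size, so the factor cancels in every comparison.\<close>

definition mset_entropy :: "'a multiset \<Rightarrow> real" where
  "mset_entropy A = (\<Sum>x\<in>set_mset A. real (count A x) * ln (real (size A) / real (count A x)))"

lemma set_mset_repeat_mset: "K > 0 \<Longrightarrow> set_mset (repeat_mset K A) = set_mset A"
  by (induction K rule: nat_induct_non_zero) auto

text \<open>
  The left-hand side is the probability that independent letters with distribution \<open>p\<close> spell a
  word of type \<open>A\<close>. For \<open>p\<close> the frequencies of \<open>A\<close> this is the entropy bound.
\<close>

lemma card_permutations_of_multiset_weight_le_1:
  fixes p :: "'a \<Rightarrow> real"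
  assumes "finite S" "\<And>x. x \<in> S \<Longrightarrow> 0 \<le> p x" "sum p S \<le> 1" "set_mset A \<subseteq> S"
  shows "real (card (permutations_of_multiset A)) * (\<Prod>x\<in>#A. p x) \<le> 1"
  using assms(4)
proof (induction "size A" arbitrary: A)
  case 0
  then show ?case by simp
next
  case (Suc n)
  have ne: "A \<noteq> {#}" using Suc.hyps(2) by auto
  have pos: "0 \<le> (\<Prod>x\<in>#A. p x)"
    using Suc.prems assms(2) by (induction A) auto
  \<comment> \<open>Split the words by their first letter \<open>x\<close>: its weight
    \<open>p x\<close> factors out, the tail is covered by the induction hypothesis, and the
    remaining weights sum to at most \<open>sum p S\<close>.\<close>
  have "real (card (permutations_of_multiset A)) \<le>
      (\<Sum>x\<in>set_mset A. real (card (permutations_of_multiset (A - {#x#}))))"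
  proof -
    have "card (permutations_of_multiset A) \<le>
        (\<Sum>x\<in>set_mset A. card ((#) x ` permutations_of_multiset (A - {#x#})))"
      unfolding permutations_of_multiset_nonempty[OF ne] by (rule card_UN_le) simp
    also have "\<dots> \<le> (\<Sum>x\<in>set_mset A. card (permutations_of_multiset (A - {#x#})))"
      by (intro sum_mono card_image_le) simp
    finally show ?thesis
      by (simp flip: of_nat_sum)
  qed
  then have "real (card (permutations_of_multiset A)) * (\<Prod>x\<in>#A. p x) \<le>
      (\<Sum>x\<in>set_mset A. real (card (permutations_of_multiset (A - {#x#}))) * (\<Prod>x\<in>#A. p x))"
    unfolding sum_distrib_right[symmetric] using pos by (rule mult_right_mono)
  also have "\<dots> \<le> (\<Sum>x\<in>set_mset A. p x)"
  proof (rule sum_mono)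
    fix x assume x: "x \<in># A"
    have prod: "(\<Prod>x\<in>#A. p x) = p x * (\<Prod>x\<in>#A - {#x#}. p x)"
      by (metis image_mset_add_mset insert_DiffM prod_mset.add_mset x)
    have "real (card (permutations_of_multiset (A - {#x#}))) * (\<Prod>x\<in>#A. p x)
       = p x * (real (card (permutations_of_multiset (A - {#x#}))) * (\<Prod>x\<in>#A - {#x#}. p x))"
      by (simp add: prod)
    also have "\<dots> \<le> p x * 1"
    proof (rule mult_left_mono)
      show "real (card (permutations_of_multiset (A - {#x#}))) * (\<Prod>x\<in>#A - {#x#}. p x) \<le> 1"
        using Suc.hyps(2) Suc.prems x by (intro Suc.hyps(1)) (auto simp: size_Diff_singleton dest: in_diffD)
      show "0 \<le> p x" using x Suc.prems assms(2) by auto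
    qed
    finally show "real (card (permutations_of_multiset (A - {#x#}))) * (\<Prod>x\<in>#A. p x) \<le> p x"
      by simp
  qed
  also have "\<dots> \<le> sum p S"
    using assms Suc.prems by (intro sum_mono2) auto
  finally show ?case using assms(3) by simp
qed

lemma card_permutations_of_multiset_pos: "card (permutations_of_multiset A) > 0"
  by (simp add: card_gt_0_iff)

lemma ln_card_permutations_of_repeat_mset_le:
  "ln (real (card (permutations_of_multiset (repeat_mset K A)))) \<le> real K * mset_entropy A"
proof (cases "K = 0 \<or> A = {#}")
  case True
  then show ?thesis by (auto simp: mset_entropy_def)
next
  case False
  then have n0: "size A > 0" by (auto simp: size_eq_0_iff_empty nonempty_has_size)
  define p where "p x = real (count A x) / real (size A)" for x
  have pp: "p x > 0" if "x \<in># A" for x using that n0 by (simp add: p_def)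
  have "(\<Sum>x\<in>set_mset A. p x) = real (size A) / real (size A)"
    unfolding p_def sum_divide_distrib[symmetric] by (simp add: size_multiset_overloaded_eq)
  then have "(\<Sum>x\<in>set_mset A. p x) = 1" using False by simp
  then have "real (card (permutations_of_multiset (repeat_mset K A))) * (\<Prod>x\<in>#repeat_mset K A. p x) \<le> 1"
    by (intro card_permutations_of_multiset_weight_le_1[where S = "set_mset A"])
       (use False in \<open>auto simp: p_def set_mset_repeat_mset\<close>)
  \<comment> \<open>All words of the type \<open>repeat_mset K A\<close> are equally probable under
    the frequencies of \<open>A\<close>, so their number is at most the inverse of this probability,
    with no error term.\<close>
  moreover have "(\<Prod>x\<in>#repeat_mset K A. p x) = exp (- (real K * mset_entropy A))"
  proof -
    have "(\<Prod>x\<in>#repeat_mset K A. p x) = (\<Prod>x\<in>set_mset A. p x ^ (K * count A x))"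
      using False by (subst image_prod_mset_multiplicity) (simp add: set_mset_repeat_mset)
    also have "\<dots> = (\<Prod>x\<in>set_mset A. exp (- (real K * (real (count A x) * ln (real (size A) / real (count A x))))))"
    proof (rule prod.cong)
      fix x assume x: "x \<in># A"
      have c: "count A x > 0" using x by simp
      have "p x ^ (K * count A x) = exp (ln (p x)) ^ (K * count A x)"
        using pp[OF x] by simp
      also have "\<dots> = exp (real (K * count A x) * ln (p x))"
        by (rule exp_of_nat_mult[symmetric])
      also have "ln (p x) = - ln (real (size A) / real (count A x))"
        using n0 c by (simp add: p_def ln_div)
      finally show "p x ^ (K * count A x) = exp (- (real K * (real (count A x) * ln (real (size A) / real (count A x)))))"
        by (simp add: mult_ac)
    qed simp
    also have "\<dots> = exp (- (real K * mset_entropy A))"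
      by (simp add: exp_sum[symmetric] mset_entropy_def sum_negf sum_distrib_left)
    finally show ?thesis .
  qed
  ultimately have "real (card (permutations_of_multiset (repeat_mset K A))) \<le> exp (real K * mset_entropy A)"
    by (simp add: exp_minus field_simps)
  then have "ln (real (card (permutations_of_multiset (repeat_mset K A)))) \<le> ln (exp (real K * mset_entropy A))"
    using card_permutations_of_multiset_pos[of "repeat_mset K A"] by (intro ln_mono) auto
  then show ?thesis by simp
qed

text \<open>Crude Stirling bound: the step from \<open>m\<close> to \<open>Suc m\<close> reduces to
  \<open>m * ln (1 + 1/m) \<le> 1\<close>.\<close>

lemma ln_fact_lower: "real m * ln (real m) - real m \<le> ln (fact m)"
proof (induction m)
  case (Suc m)
  show ?case
  proof (cases "m = 0")
    case False
    have "ln (real (Suc m) / real m) \<le> real (Suc m) / real m - 1"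
      using False by (intro ln_le_minus_one) simp
    also have "real (Suc m) / real m - 1 = 1 / real m"
      using False by (simp add: divide_simps)
    finally have "ln (real (Suc m)) - ln (real m) \<le> 1 / real m"
      using False by (simp add: ln_div del: of_nat_Suc)
    then have "real m * (ln (real (Suc m)) - ln (real m)) \<le> real m * (1 / real m)"
      by (intro mult_left_mono) auto
    then have "real m * ln (real (Suc m)) - real m * ln (real m) \<le> 1"
      using False by (simp add: right_diff_distrib)
    moreover have "ln (fact (Suc m) :: real) = ln (real (Suc m)) + ln (fact m)"
      by (simp add: ln_mult del: of_nat_Suc)
    moreover have "real (Suc m) * ln (real (Suc m)) = real m * ln (real (Suc m)) + ln (real (Suc m))"
      by (simp add: distrib_right)
    ultimately show ?thesis using Suc.IH by linarith
  qed simp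
qed simp

text \<open>The companion bound needs \<open>(m + 1) * ln (1 + 1/m) \<ge> 1\<close>. The two bounds
  differ only by \<open>ln m + 1\<close>, which is negligible after division by
  \<open>m\<close>.\<close>

lemma ln_fact_upper:
  assumes "m > 0"
  shows "ln (fact m) \<le> real m * ln (real m) - real m + ln (real m) + 1"
  using assms
proof (induction m rule: nat_induct_non_zero)
  case (Suc m)
  have "ln (real m / real (Suc m)) \<le> real m / real (Suc m) - 1"
    using Suc.hyps by (intro ln_le_minus_one) simp
  also have "real m / real (Suc m) - 1 = - 1 / real (Suc m)"
    by (simp add: divide_simps)
  finally have "ln (real m) - ln (real (Suc m)) \<le> - 1 / real (Suc m)"
    using Suc.hyps by (simp add: ln_div del: of_nat_Suc)
  then have "real (Suc m) * (ln (real m) - ln (real (Suc m))) \<le> real (Suc m) * (- 1 / real (Suc m))"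
    by (intro mult_left_mono) auto
  then have "real (Suc m) * ln (real m) - real (Suc m) * ln (real (Suc m)) \<le> - 1"
    by (simp add: right_diff_distrib del: of_nat_Suc)
  moreover have "ln (fact (Suc m) :: real) = ln (real (Suc m)) + ln (fact m)"
    by (simp add: ln_mult del: of_nat_Suc)
  moreover have "real (Suc m) * ln (real m) = real m * ln (real m) + ln (real m)"
    by (simp add: distrib_right)
  ultimately show ?case using Suc.IH by linarith
qed simp

text \<open>The count is a multinomial coefficient. Apply the lower factorial bound to the numerator
  and the upper one to the denominators: the linear terms cancel because the multiplicities sum to
  the size, and each letter costs one logarithmic error.\<close>

lemma ln_card_permutations_of_repeat_mset_ge:
  assumes "K > 0"
  shows "real K * mset_entropy A - (\<Sum>x\<in>set_mset A. ln (real K) + ln (real (count A x)) + 1)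
    \<le> ln (real (card (permutations_of_multiset (repeat_mset K A))))"
proof -
  let ?S = "set_mset A" and ?n = "size A"
  have nn: "real (K * ?n) = (\<Sum>x\<in>?S. real (K * count A x))"
    by (simp add: size_multiset_overloaded_eq sum_distrib_left)
  have "real (card (permutations_of_multiset (repeat_mset K A))) =
      fact (K * ?n) / (\<Prod>x\<in>?S. fact (K * count A x))"
  proof -
    have "card (permutations_of_multiset (repeat_mset K A)) * (\<Prod>x\<in>?S. fact (K * count A x)) = fact (K * ?n)"
      using card_permutations_of_multiset_aux[of "repeat_mset K A"] assms
      by (simp add: mult_ac set_mset_repeat_mset)
    then have "real (card (permutations_of_multiset (repeat_mset K A)) * (\<Prod>x\<in>?S. fact (K * count A x))) = real (fact (K * ?n))"
      by simp
    then show ?thesis by (simp add: field_simps)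
  qed
  then have card: "ln (real (card (permutations_of_multiset (repeat_mset K A)))) =
      ln (fact (K * ?n)) - (\<Sum>x\<in>?S. ln (fact (K * count A x)))"
    by (simp add: ln_div ln_prod prod_pos)
  have "(\<Sum>x\<in>?S. ln (fact (K * count A x))) \<le>
      (\<Sum>x\<in>?S. real (K * count A x) * ln (real (K * count A x)) - real (K * count A x)
        + ln (real (K * count A x)) + 1)"
    using assms by (intro sum_mono ln_fact_upper) simp
  also have "\<dots> = (\<Sum>x\<in>?S. real (K * count A x) * ln (real (K * ?n)))
      - real K * mset_entropy A - (\<Sum>x\<in>?S. real (K * count A x))
      + (\<Sum>x\<in>?S. ln (real K) + ln (real (count A x)) + 1)"
    unfolding mset_entropy_def sum_distrib_left sum.distrib[symmetric] sum_subtractf[symmetric]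
  proof (rule sum.cong)
    fix x assume x: "x \<in># A"
    then have "?n > 0" "count A x > 0" by (auto simp: nonempty_has_size[symmetric])
    then show "real (K * count A x) * ln (real (K * count A x)) - real (K * count A x)
        + ln (real (K * count A x)) + 1 =
      real (K * count A x) * ln (real (K * ?n))
        - real K * (real (count A x) * ln (real ?n / real (count A x))) - real (K * count A x)
        + (ln (real K) + ln (real (count A x)) + 1)"
      using assms by (simp add: ln_mult ln_div algebra_simps)
  qed simp
  also have "(\<Sum>x\<in>?S. real (K * count A x) * ln (real (K * ?n))) = real (K * ?n) * ln (real (K * ?n))"
    by (simp only: nn sum_distrib_right)
  finally show ?thesis
    using ln_fact_lower[of "K * ?n"] card nn by simp
qed

text \<open>The total error is a fixed multiple of \<open>ln K\<close> plus a constant, hence o(K),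
  and any gap below the entropy absorbs it.\<close>

lemma eventually_ln_card_permutations_of_repeat_mset_gt:
  assumes "c < mset_entropy A"
  shows "\<forall>\<^sub>F K in sequentially.
    real K * c < ln (real (card (permutations_of_multiset (repeat_mset K A))))"
proof -
  let ?S = "set_mset A"
  define C where "C = (\<Sum>x\<in>?S. ln (real (count A x)) + 1)"
  have "(\<lambda>K. (real (card ?S) * ln (real K) + C) / real K) \<longlonglongrightarrow> 0"
    by real_asymp
  then have "\<forall>\<^sub>F K in sequentially. (real (card ?S) * ln (real K) + C) / real K < mset_entropy A - c"
    using assms by (intro order_tendstoD(2)) auto
  with eventually_gt_at_top[of 0] show ?thesis
  proof eventually_elim
    case (elim K)
    have "(\<Sum>x\<in>?S. ln (real K) + ln (real (count A x)) + 1) = real (card ?S) * ln (real K) + C"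
      by (simp add: C_def sum.distrib)
    moreover have "real (card ?S) * ln (real K) + C < real K * mset_entropy A - real K * c"
      using elim by (simp add: field_simps)
    ultimately show ?case
      using ln_card_permutations_of_repeat_mset_ge[OF elim(1), of A] by linarith
  qed
qed

section \<open>From weighted points to finite sets\<close>

text \<open>Digits may be negative; only their differences have to be smaller than the base. The
  leading entries of the two lists are congruent modulo \<open>B\<close>, hence equal.\<close>

lemma horner_sum_inj:
  fixes B :: int
  assumes "\<And>d e. d \<in> D \<Longrightarrow> e \<in> D \<Longrightarrow> \<bar>d - e\<bar> < B"
  assumes "length ds = length es" "set ds \<subseteq> D" "set es \<subseteq> D"
    "horner_sum id B ds = horner_sum id B es"
  shows "ds = es"
  using assms(2-)
proof (induction rule: list_induct2)
  case (Cons d ds e es)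
  have "d - e = B * (horner_sum id B es - horner_sum id B ds)"
    using Cons.prems by (simp add: algebra_simps id_def)
  then have "B dvd d - e" by simp
  moreover have "\<bar>d - e\<bar> < B" using assms(1) Cons.prems by simp
  ultimately have "d = e"
    using dvd_imp_le_int[of "d - e" B] by fastforce
  \<comment> \<open>Taking both digits equal in the hypothesis gives \<open>0 < B\<close>, so the
    factor \<open>B\<close> cancels.\<close>
  with Cons show ?case using assms(1)[of e e] by simp
qed simp

text \<open>The strict inequalities leave room for the subexponential loss in the count of words, so
  one sufficiently large \<open>K\<close> serves all three projections.\<close>

lemma not_SD_if_mset_entropy:
  fixes A :: "(int \<times> int) multiset"
  assumes inj: "inj_on (\<lambda>(a, b). a - b) (set_mset A)"
    and t: "t > 0"
    and hx: "t * mset_entropy (image_mset fst A) < mset_entropy A"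
    and hy: "t * mset_entropy (image_mset snd A) < mset_entropy A"
    and hs: "t * mset_entropy (image_mset (\<lambda>(a, b). a + b) A) < mset_entropy A"
  shows "\<exists>\<alpha>>t. not_SD [Fin 0, Fin 1, Infty] \<alpha>"
proof -
  let ?dif = "\<lambda>(a, b). a - b :: int" and ?add = "\<lambda>(a, b). a + b :: int"
  define D where "D = ?dif ` set_mset A"
  \<comment> \<open>Any base exceeding all differences between elements of \<open>D\<close> would
    do; the sum of all of them plus one is such a number.\<close>
  define B where "B = 1 + (\<Sum>(d, e)\<in>D \<times> D. \<bar>d - e\<bar>)"
  have B: "\<bar>d - e\<bar> < B" if "d \<in> D" "e \<in> D" for d e
  proof -
    have "\<bar>d - e\<bar> \<le> (\<Sum>(d, e)\<in>D \<times> D. \<bar>d - e\<bar>)"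
      using member_le_sum[of "(d, e)" "D \<times> D" "\<lambda>(d, e). \<bar>d - e\<bar>"] that by (auto simp: D_def)
    then show ?thesis by (simp add: B_def)
  qed
  \<comment> \<open>A single threshold dominating the three projections. Including 0 makes
    \<open>ln (card G)\<close> strictly positive later; it is admissible since the entropy of
    \<open>A\<close> is positive.\<close>
  define c where "c = Max {0, t * mset_entropy (image_mset fst A), t * mset_entropy (image_mset snd A),
    t * mset_entropy (image_mset ?add A)}"
  have "mset_entropy A > 0"
  proof -
    have "0 \<le> ln (real (card (permutations_of_multiset (image_mset fst A))))"
      using card_permutations_of_multiset_pos[of "image_mset fst A"] by (intro ln_ge_zero) linarith
    also have "\<dots> \<le> mset_entropy (image_mset fst A)"
      using ln_card_permutations_of_repeat_mset_le[of 1 "image_mset fst A"] by simp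
    finally have "0 \<le> t * mset_entropy (image_mset fst A)" using t by simp
    with hx show ?thesis by linarith
  qed
  then have "c < mset_entropy A" using hx hy hs by (simp add: c_def)
  from eventually_happens'[OF sequentially_bot eventually_ln_card_permutations_of_repeat_mset_gt[OF this]]
  obtain K where K: "real K * c < ln (real (card (permutations_of_multiset (repeat_mset K A))))"
    by blast
  define P where "P = permutations_of_multiset (repeat_mset K A)"
  \<comment> \<open>Reading a word in base \<open>B\<close> is linear in its letters, so projecting
    the pair agrees with reading the word of projected letters.\<close>
  define E where "E ws = (real_of_int (horner_sum fst B ws), real_of_int (horner_sum snd B ws))" for ws
  define G where "G = E ` P"
  have horner_map: "horner_sum f B ws = horner_sum id B (map f ws)" for f :: "int \<times> int \<Rightarrow> int" and ws
    by (induction ws) auto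
  have horner_dif: "horner_sum ?dif B ws = horner_sum fst B ws - horner_sum snd B ws" for ws
    by (induction ws) (simp_all add: case_prod_beta right_diff_distrib)
  have horner_add: "horner_sum ?add B ws = horner_sum fst B ws + horner_sum snd B ws" for ws
    by (induction ws) (simp_all add: case_prod_beta distrib_left)
  have P: "length ws = K * size A" "set ws \<subseteq> set_mset A" if "ws \<in> P" for ws
  proof -
    have ws: "mset ws = repeat_mset K A" using that by (simp add: P_def permutations_of_multisetD)
    then show "length ws = K * size A" by (metis size_mset size_repeat_mset)
    from ws have "set ws = set_mset (repeat_mset K A)" by (metis set_mset_mset)
    then show "set ws \<subseteq> set_mset A" by (cases "K = 0") (auto simp: set_mset_repeat_mset)
  qed
  \<comment> \<open>The value determines the word of differences by uniqueness of digits, and each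
    difference determines its letter because \<open>a - b\<close> is injective on the
    support.\<close>
  have "inj_on (horner_sum ?dif B) P"
  proof (rule inj_onI)
    fix ws vs assume wv: "ws \<in> P" "vs \<in> P" "horner_sum ?dif B ws = horner_sum ?dif B vs"
    have "map ?dif ws = map ?dif vs"
    proof (rule horner_sum_inj[OF B])
      show "set (map ?dif ws) \<subseteq> D" "set (map ?dif vs) \<subseteq> D"
        using P(2) wv by (force simp: D_def)+
    qed (use P(1) wv horner_map in simp_all)
    moreover have "inj_on ?dif (set ws \<union> set vs)"
      using inj by (rule inj_on_subset) (use P(2) wv in blast)
    ultimately show "ws = vs" by (rule map_inj_on)
  qed
  moreover have "proj (Fin (- 1)) (E ws) = real_of_int (horner_sum ?dif B ws)" for ws
    by (simp add: E_def horner_dif of_rat_minus)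
  ultimately have "inj_on (proj (Fin (- 1)) \<circ> E) P"
    by (auto simp: inj_on_def)
  then have injG: "inj_on (proj (Fin (- 1))) G" and "inj_on E P"
    unfolding G_def by (auto intro: inj_on_imageI dest: inj_on_imageI2)
  then have cardG: "card G = card P" by (simp add: G_def card_image)
  have finG: "finite G" by (simp add: G_def P_def)
  \<comment> \<open>The projection of \<open>E ws\<close> depends only on \<open>map f ws\<close>, a
    word of the pushed-forward type. Collisions between such words only help, as an upper bound is
    all that is wanted.\<close>
  have img: "real (card (proj r ` G)) \<le> real (card (permutations_of_multiset (repeat_mset K (image_mset f A))))"
    if r: "\<And>ws. proj r (E ws) = real_of_int (horner_sum f B ws)" for r and f :: "int \<times> int \<Rightarrow> int"
  proof -
    have "proj r ` G = (\<lambda>xs. real_of_int (horner_sum id B xs)) ` map f ` P"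
      unfolding G_def image_image r by (subst horner_map) simp
    then have "card (proj r ` G) \<le> card (map f ` P)"
      by (simp add: card_image_le P_def)
    also have "map f ` P \<subseteq> permutations_of_multiset (repeat_mset K (image_mset f A))"
    proof -
      have "image_mset f (repeat_mset K A) = repeat_mset K (image_mset f A)"
        by (induction K) auto
      then show ?thesis by (auto simp: P_def permutations_of_multiset_def)
    qed
    then have "card (map f ` P) \<le> card (permutations_of_multiset (repeat_mset K (image_mset f A)))"
      by (simp add: card_mono)
    finally show ?thesis by simp
  qed
  define L where "L r = ln (real (card (proj r ` G)))" for r
  have Gne: "G \<noteq> {}" by (simp add: G_def P_def)
  have bound: "t * L r < ln (real (card G))"
    if r: "\<And>ws. proj r (E ws) = real_of_int (horner_sum f B ws)" and f: "t * mset_entropy (image_mset f A) \<le> c"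
    for r and f :: "int \<times> int \<Rightarrow> int"
  proof -
    have "0 < card (proj r ` G)" using Gne finG by (simp add: card_gt_0_iff)
    then have "L r \<le> real K * mset_entropy (image_mset f A)"
      unfolding L_def using img[OF r]
      by (intro order_trans[OF _ ln_card_permutations_of_repeat_mset_le] ln_mono) auto
    then have "t * L r \<le> t * (real K * mset_entropy (image_mset f A))"
      using t by (intro mult_left_mono) auto
    also have "\<dots> = real K * (t * mset_entropy (image_mset f A))" by simp
    also have "\<dots> \<le> real K * c" using f by (intro mult_left_mono) auto
    also have "\<dots> < ln (real (card G))" using K by (simp add: cardG P_def)
    finally show ?thesis .
  qed
  have b0: "t * L (Fin 0) < ln (real (card G))"
    by (rule bound[of _ fst]) (simp_all add: E_def c_def)
  have b1: "t * L (Fin 1) < ln (real (card G))"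
    by (rule bound[of _ ?add]) (simp_all add: E_def c_def horner_add)
  have b2: "t * L Infty < ln (real (card G))"
    by (rule bound[of _ snd]) (simp_all add: E_def c_def)
  define M where "M = Max (L ` set [Fin 0, Fin 1, Infty])"
  have M: "t * M < ln (real (card G))"
  proof -
    have "M \<in> L ` set [Fin 0, Fin 1, Infty]" unfolding M_def by (rule Max_in) auto
    then show ?thesis using b0 b1 b2 by auto
  qed
  have lnG: "ln (real (card G)) > 0"
  proof -
    have "0 \<le> real K * c" by (simp add: c_def)
    with K show ?thesis by (simp add: cardG P_def)
  qed
  \<comment> \<open>This makes the quotient a genuine one. Otherwise both coordinate projections
    would have at most one value, so \<open>G\<close> would have at most one point, against
    \<open>lnG\<close>.\<close>
  have "M > 0"
  proof (rule ccontr)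
    assume "\<not> M > 0"
    moreover have "L (Fin 0) \<le> M" "L Infty \<le> M" unfolding M_def by (intro Max_ge; simp)+
    ultimately have "L (Fin 0) \<le> 0" "L Infty \<le> 0" by linarith+
    moreover have "0 < card (proj r ` G)" for r using Gne finG by (simp add: card_gt_0_iff)
    ultimately have le1: "card (proj (Fin 0) ` G) \<le> 1" "card (proj Infty ` G) \<le> 1"
      by (simp_all add: L_def)
    have "G \<subseteq> proj (Fin 0) ` G \<times> proj Infty ` G"
      by (force simp: image_iff)
    then have "card G \<le> card (proj (Fin 0) ` G) * card (proj Infty ` G)"
      unfolding card_cartesian_product[symmetric] using finG by (intro card_mono) auto
    also have "\<dots> \<le> 1 * 1" using le1 by (rule mult_le_mono)
    finally have "card G \<le> 1" by simp
    moreover have "card G > 0" using Gne finG by (simp add: card_gt_0_iff)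
    ultimately show False using lnG by simp
  qed
  show ?thesis
  proof (intro exI conjI)
    show "t < ln (real (card G)) / M"
      using M \<open>M > 0\<close> by (simp add: field_simps)
    show "not_SD [Fin 0, Fin 1, Infty] (ln (real (card G)) / M)"
      unfolding not_SD_def
    proof (intro conjI exI)
      show "Max ((\<lambda>r. ln (real (card (proj r ` G)))) ` set [Fin 0, Fin 1, Infty]) \<noteq> 0"
        "ln (real (card G)) / M = ln (real (card G)) / Max ((\<lambda>r. ln (real (card (proj r ` G)))) ` set [Fin 0, Fin 1, Infty])"
        using \<open>M > 0\<close> by (simp_all add: M_def L_def[abs_def])
    qed (use finG injG in simp_all)
  qed
qed

section \<open>Numerical verification\<close>

text \<open>
  The series for \<open>ln (p / (p - 1))\<close> converges quickly, and since \<open>p - 1\<close> is a product of smaller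
  primes for each prime \<open>p\<close> used below, these differences determine the logarithms of the primes.
\<close>

lemma ln_ratio_bounds:
  fixes n :: nat and p a b :: real
  defines "y \<equiv> \<lambda>p. 1 / (2 * p - 1)"
  defines "s \<equiv> \<lambda>p n. \<Sum>k<n. 2 * y p ^ (2 * k + 1) / real (2 * k + 1)"
  assumes "p > 1" "a \<le> s p n" "s p n + 2 * (y p ^ (2 * n + 1) / (1 - (y p)\<^sup>2) / real (2 * n + 1)) \<le> b"
  shows "ln p - ln (p - 1) \<in> {a..b}"
proof -
  have "ln p - ln (p - 1) = ln (p / (p - 1))"
    using assms(3) by (simp add: ln_div)
  \<comment> \<open>The series is \<open>ln x = 2 * (y + y^3/3 + y^5/5 + ...)\<close> with
    \<open>y = (x - 1) / (x + 1)\<close>, and its tail is bounded by a geometric series.\<close>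
  moreover have "(p / (p - 1) - 1) / (p / (p - 1) + 1) = y p"
    using assms(3) by (simp add: y_def divide_simps)
  ultimately show ?thesis
    using ln_approx_bounds[of "p / (p - 1)" n] assms(3-5) by (simp add: s_def)
qed

text \<open>These are exactly the primes dividing the size and the multiplicities of the final
  multiset. Larger primes need fewer terms because \<open>1 / (2 * p - 1)\<close> is
  smaller.\<close>

lemma ln_prime_bounds:
  shows "ln 2 \<in> {693147180 / 1000000000 .. 693147181 / 1000000000 :: real}"
    and "ln 3 - ln 2 \<in> {405465108 / 1000000000 .. 405465109 / 1000000000 :: real}"
    and "ln 5 - ln 4 \<in> {223143551 / 1000000000 .. 223143552 / 1000000000 :: real}"
    and "ln 7 - ln 6 \<in> {154150679 / 1000000000 .. 154150680 / 1000000000 :: real}"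
    and "ln 11 - ln 10 \<in> {95310179 / 1000000000 .. 95310180 / 1000000000 :: real}"
    and "ln 13 - ln 12 \<in> {80042707 / 1000000000 .. 80042708 / 1000000000 :: real}"
    and "ln 19 - ln 18 \<in> {54067221 / 1000000000 .. 54067222 / 1000000000 :: real}"
    and "ln 29 - ln 28 \<in> {35091319 / 1000000000 .. 35091320 / 1000000000 :: real}"
    and "ln 43 - ln 42 \<in> {23530497 / 1000000000 .. 23530498 / 1000000000 :: real}"
    and "ln 53 - ln 52 \<in> {19048194 / 1000000000 .. 19048195 / 1000000000 :: real}"
proof -
  show "ln 2 \<in> {693147180 / 1000000000 .. 693147181 / 1000000000 :: real}"
    using ln_ratio_bounds[of 2 "693147180 / 1000000000" 9 "693147181 / 1000000000"]
    by (simp add: lessThan_nat_numeral power_divide)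
  show "ln 3 - ln 2 \<in> {405465108 / 1000000000 .. 405465109 / 1000000000 :: real}"
    using ln_ratio_bounds[of 3 "405465108 / 1000000000" 7 "405465109 / 1000000000"]
    by (simp add: lessThan_nat_numeral power_divide)
  show "ln 5 - ln 4 \<in> {223143551 / 1000000000 .. 223143552 / 1000000000 :: real}"
    using ln_ratio_bounds[of 5 "223143551 / 1000000000" 5 "223143552 / 1000000000"]
    by (simp add: lessThan_nat_numeral power_divide)
  show "ln 7 - ln 6 \<in> {154150679 / 1000000000 .. 154150680 / 1000000000 :: real}"
    using ln_ratio_bounds[of 7 "154150679 / 1000000000" 4 "154150680 / 1000000000"]
    by (simp add: lessThan_nat_numeral power_divide)
  show "ln 11 - ln 10 \<in> {95310179 / 1000000000 .. 95310180 / 1000000000 :: real}"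
    using ln_ratio_bounds[of 11 "95310179 / 1000000000" 3 "95310180 / 1000000000"]
    by (simp add: lessThan_nat_numeral power_divide)
  show "ln 13 - ln 12 \<in> {80042707 / 1000000000 .. 80042708 / 1000000000 :: real}"
    using ln_ratio_bounds[of 13 "80042707 / 1000000000" 3 "80042708 / 1000000000"]
    by (simp add: lessThan_nat_numeral power_divide)
  show "ln 19 - ln 18 \<in> {54067221 / 1000000000 .. 54067222 / 1000000000 :: real}"
    using ln_ratio_bounds[of 19 "54067221 / 1000000000" 3 "54067222 / 1000000000"]
    by (simp add: lessThan_nat_numeral power_divide)
  show "ln 29 - ln 28 \<in> {35091319 / 1000000000 .. 35091320 / 1000000000 :: real}"
    using ln_ratio_bounds[of 29 "35091319 / 1000000000" 2 "35091320 / 1000000000"]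
    by (simp add: lessThan_nat_numeral power_divide)
  show "ln 43 - ln 42 \<in> {23530497 / 1000000000 .. 23530498 / 1000000000 :: real}"
    using ln_ratio_bounds[of 43 "23530497 / 1000000000" 2 "23530498 / 1000000000"]
    by (simp add: lessThan_nat_numeral power_divide)
  show "ln 53 - ln 52 \<in> {19048194 / 1000000000 .. 19048195 / 1000000000 :: real}"
    using ln_ratio_bounds[of 53 "19048194 / 1000000000" 2 "19048195 / 1000000000"]
    by (simp add: lessThan_nat_numeral power_divide)
qed

text \<open>The first eight numbers are the predecessors of primes in the enclosures above; the
  others are the size and the multiplicities of the final multiset and its images.\<close>

lemma ln_composites:
  shows "ln (4 :: real) = 2 * ln 2"
    and "ln (6 :: real) = ln 2 + ln 3"
    and "ln (10 :: real) = ln 2 + ln 5"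
    and "ln (12 :: real) = 2 * ln 2 + ln 3"
    and "ln (18 :: real) = ln 2 + 2 * ln 3"
    and "ln (28 :: real) = 2 * ln 2 + ln 7"
    and "ln (42 :: real) = ln 2 + ln 3 + ln 7"
    and "ln (52 :: real) = 2 * ln 2 + ln 13"
    and "ln (4664 :: real) = 3 * ln 2 + ln 11 + ln 53"
    and "ln (2310 :: real) = ln 2 + ln 3 + ln 5 + ln 7 + ln 11"
    and "ln (1044 :: real) = 2 * ln 2 + 2 * ln 3 + ln 29"
    and "ln (132 :: real) = 2 * ln 2 + ln 3 + ln 11"
    and "ln (133 :: real) = ln 7 + ln 19"
    and "ln (3354 :: real) = ln 2 + ln 3 + ln 13 + ln 43"
    and "ln (1176 :: real) = 3 * ln 2 + ln 3 + 2 * ln 7"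
    and "ln (2574 :: real) = ln 2 + 2 * ln 3 + ln 11 + ln 13"
    and "ln (2090 :: real) = ln 2 + ln 5 + ln 11 + ln 19"
proof -
  have "4 = (2 ^ 2 :: real)" by simp
  then show "ln (4 :: real) = 2 * ln 2"
    by (simp only: ln_mult_pos ln_realpow of_nat_numeral zero_less_numeral zero_less_power mult_pos_pos)
  have "6 = (2 * 3 :: real)" by simp
  then show "ln (6 :: real) = ln 2 + ln 3"
    by (simp only: ln_mult_pos ln_realpow of_nat_numeral zero_less_numeral zero_less_power mult_pos_pos)
  have "10 = (2 * 5 :: real)" by simp
  then show "ln (10 :: real) = ln 2 + ln 5"
    by (simp only: ln_mult_pos ln_realpow of_nat_numeral zero_less_numeral zero_less_power mult_pos_pos)
  have "12 = (2 ^ 2 * 3 :: real)" by simp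
  then show "ln (12 :: real) = 2 * ln 2 + ln 3"
    by (simp only: ln_mult_pos ln_realpow of_nat_numeral zero_less_numeral zero_less_power mult_pos_pos)
  have "18 = (2 * 3 ^ 2 :: real)" by simp
  then show "ln (18 :: real) = ln 2 + 2 * ln 3"
    by (simp only: ln_mult_pos ln_realpow of_nat_numeral zero_less_numeral zero_less_power mult_pos_pos)
  have "28 = (2 ^ 2 * 7 :: real)" by simp
  then show "ln (28 :: real) = 2 * ln 2 + ln 7"
    by (simp only: ln_mult_pos ln_realpow of_nat_numeral zero_less_numeral zero_less_power mult_pos_pos)
  have "42 = (2 * 3 * 7 :: real)" by simp
  then show "ln (42 :: real) = ln 2 + ln 3 + ln 7"
    by (simp only: ln_mult_pos ln_realpow of_nat_numeral zero_less_numeral zero_less_power mult_pos_pos)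
  have "52 = (2 ^ 2 * 13 :: real)" by simp
  then show "ln (52 :: real) = 2 * ln 2 + ln 13"
    by (simp only: ln_mult_pos ln_realpow of_nat_numeral zero_less_numeral zero_less_power mult_pos_pos)
  have "4664 = (2 ^ 3 * 11 * 53 :: real)" by simp
  then show "ln (4664 :: real) = 3 * ln 2 + ln 11 + ln 53"
    by (simp only: ln_mult_pos ln_realpow of_nat_numeral zero_less_numeral zero_less_power mult_pos_pos)
  have "2310 = (2 * 3 * 5 * 7 * 11 :: real)" by simp
  then show "ln (2310 :: real) = ln 2 + ln 3 + ln 5 + ln 7 + ln 11"
    by (simp only: ln_mult_pos ln_realpow of_nat_numeral zero_less_numeral zero_less_power mult_pos_pos)
  have "1044 = (2 ^ 2 * 3 ^ 2 * 29 :: real)" by simp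
  then show "ln (1044 :: real) = 2 * ln 2 + 2 * ln 3 + ln 29"
    by (simp only: ln_mult_pos ln_realpow of_nat_numeral zero_less_numeral zero_less_power mult_pos_pos)
  have "132 = (2 ^ 2 * 3 * 11 :: real)" by simp
  then show "ln (132 :: real) = 2 * ln 2 + ln 3 + ln 11"
    by (simp only: ln_mult_pos ln_realpow of_nat_numeral zero_less_numeral zero_less_power mult_pos_pos)
  have "133 = (7 * 19 :: real)" by simp
  then show "ln (133 :: real) = ln 7 + ln 19"
    by (simp only: ln_mult_pos ln_realpow of_nat_numeral zero_less_numeral zero_less_power mult_pos_pos)
  have "3354 = (2 * 3 * 13 * 43 :: real)" by simp
  then show "ln (3354 :: real) = ln 2 + ln 3 + ln 13 + ln 43"
    by (simp only: ln_mult_pos ln_realpow of_nat_numeral zero_less_numeral zero_less_power mult_pos_pos)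
  have "1176 = (2 ^ 3 * 3 * 7 ^ 2 :: real)" by simp
  then show "ln (1176 :: real) = 3 * ln 2 + ln 3 + 2 * ln 7"
    by (simp only: ln_mult_pos ln_realpow of_nat_numeral zero_less_numeral zero_less_power mult_pos_pos)
  have "2574 = (2 * 3 ^ 2 * 11 * 13 :: real)" by simp
  then show "ln (2574 :: real) = ln 2 + 2 * ln 3 + ln 11 + ln 13"
    by (simp only: ln_mult_pos ln_realpow of_nat_numeral zero_less_numeral zero_less_power mult_pos_pos)
  have "2090 = (2 * 5 * 11 * 19 :: real)" by simp
  then show "ln (2090 :: real) = ln 2 + ln 5 + ln 11 + ln 19"
    by (simp only: ln_mult_pos ln_realpow of_nat_numeral zero_less_numeral zero_less_power mult_pos_pos)
qed

theorem theorem1: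
  "\<exists>\<alpha>::real. \<alpha> > 1.77898 \<and> not_SD [Fin 0, Fin 1, Infty] \<alpha>"
proof (rule not_SD_if_mset_entropy)
  \<comment> \<open>The weights approximate a numerical optimum (ratio about 1.7789888) found by computer search;
    among those of ratio above 1.77898 they are chosen so that only primes up to 53 divide the
    multiplicities that occur in the entropies. They give a ratio of about 1.7789846.\<close>
  let ?A = "replicate_mset 2310 (1, 1) + replicate_mset 1044 (1, 2) + replicate_mset 1044 (2, 1) +
       replicate_mset 132 (0, 2) + replicate_mset 132 (2, 0) + {#(0, 3), (3, 0)#} :: (int \<times> int) multiset"
  have set: "set_mset ?A = {(1, 1), (1, 2), (2, 1), (0, 2), (2, 0), (0, 3), (3, 0)}"
    by auto
  \<comment> \<open>With n the size, the entropy is n ln n minus the sum of a ln a over the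
    multiplicities a. Points of multiplicity one subtract nothing as
    \<open>ln 1 = 0\<close>.\<close>
  have A: "mset_entropy ?A = 4664 * ln 4664 - 2310 * ln 2310 - 2088 * ln 1044 - 264 * ln 132"
    unfolding mset_entropy_def set by (simp add: ln_div)
  have set: "set_mset (image_mset fst ?A) = {0, 1, 2, 3}"
    by auto
  have fst: "mset_entropy (image_mset fst ?A) = 4664 * ln 4664 - 133 * ln 133 - 3354 * ln 3354 - 1176 * ln 1176"
    unfolding mset_entropy_def set by (simp add: ln_div)
  have set: "set_mset (image_mset snd ?A) = {0, 1, 2, 3}"
    by auto
  have snd: "mset_entropy (image_mset snd ?A) = 4664 * ln 4664 - 133 * ln 133 - 3354 * ln 3354 - 1176 * ln 1176"
    unfolding mset_entropy_def set by (simp add: ln_div)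
  \<comment> \<open>The support lies on the two lines a + b = 2 and a + b = 3, which keeps this
    entropy below \<open>ln 2\<close> per letter.\<close>
  have set: "set_mset (image_mset (\<lambda>(a, b). a + b) ?A) = {2, 3}"
    by auto
  have add: "mset_entropy (image_mset (\<lambda>(a, b). a + b) ?A) = 4664 * ln 4664 - 2574 * ln 2574 - 2090 * ln 2090"
    unfolding mset_entropy_def set by (simp add: ln_div)
  have t: "1.77898 = (88949 / 50000 :: real)" by simp
  note bounds = ln_prime_bounds[unfolded ln_composites atLeastAtMost_iff, THEN conjunct1]
    ln_prime_bounds[unfolded ln_composites atLeastAtMost_iff, THEN conjunct2]
  \<comment> \<open>The seven differences are the integers from -3 to 3, each taken once.\<close>
  show "inj_on (\<lambda>(a, b). a - b) (set_mset ?A)" by simp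
  \<comment> \<open>Once the logarithms are split into those of primes, the inequality is linear in
    them, and the rational enclosures are sharp enough to decide it.\<close>
  show "1.77898 * mset_entropy (image_mset fst ?A) < mset_entropy ?A"
    unfolding t A fst ln_composites ring_distribs using bounds by linarith
  show "1.77898 * mset_entropy (image_mset snd ?A) < mset_entropy ?A"
    unfolding t A snd ln_composites ring_distribs using bounds by linarith
  show "1.77898 * mset_entropy (image_mset (\<lambda>(a, b). a + b) ?A) < mset_entropy ?A"
    unfolding t A add ln_composites ring_distribs using bounds by linarith
qed simp

end
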